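(* Let $X_1,\ldots,X_n$ be real-valued continuous random variables on a common probability space, with ordered values $X_{1:n}\le\cdots\le X_{n:n}$, and fix $1\le k\le n$. Suppose that $(X_1,\ldots,X_n)$ satisfies Condition A (for this $k$), stated in the context. For $\{i_1,\ldots,i_k\}\subseteq\{1,\ldots,n\}$ of cardinality $k$ let $F_{i_1\ldots i_k}(x)=P\{\max_{1\le j\le k}X_{i_j}\le x\}$. Let $a_k\le\cdots\le a_n$ be real constants such that $\binom{j}{k}^{-1}F_{i_1\ldots i_k}(a_j)$ is nondecreasing in $j=k,\ldots,n$ for every $\{i_1,\ldots,i_k\}\subseteq\{1,\ldots,n\}$ of cardinality $k$. Then $$P\{X_{k:n}\ge a_k,\ldots,X_{n:n}\ge a_n\}\ \ge\ 1-\binom{n}{k}^{-1}\sum_{1\le i_1<\cdots<i_k\le n}F_{i_1\ldots i_k}(a_n).$$ Moreover, equality holds if $X_1,\ldots,X_n$ are independent and $\binom{j}{k}^{-1}F_{i_1\ldots i_k}(a_j)$ is constant in $j=k,\ldots,n$ for every $\{i_1,\ldots,i_k\}\subseteq\{1,\ldots,n\}$ of cardinality $k$.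
   Context: A random variable is called continuous if its cumulative distribution function is continuous. $X_{1:n}\le\cdots\le X_{n:n}$ denote the order statistics of $X_1,\ldots,X_n$. A function of several variables is nondecreasing (nonincreasing) if it is so in each coordinate. For $\{i_1,\ldots,i_k\}\subseteq\{1,\ldots,n\}$ of size $k$, $X_1^{-(i_1,\ldots,i_k)},\ldots,X_{n-k}^{-(i_1,\ldots,i_k)}$ denote the components of the set $(X_1,\ldots,X_n)\setminus\{X_{i_1},\ldots,X_{i_k}\}$, i.e. the remaining $n-k$ variables. Condition A (for a given $k$): for every $\{i_1,\ldots,i_k\}\subseteq\{1,\ldots,n\}$ of size $k$ and any nondecreasing (or nonincreasing) function $\phi$ (for which the expectation exists), the conditional expectation $E\{\phi(X_1^{-(i_1,\ldots,i_k)},\ldots,X_{n-k}^{-(i_1,\ldots,i_k)})\mid\max\{X_{i_1},\ldots,X_{i_k}\}=z\}$ is nondecreasing (or, respectively, nonincreasing) in $z$ (i.e. has a version that is). *)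

theory Defs
  imports "HOL-Probability.Probability"
begin

definition continuous_rv :: "'a measure \<Rightarrow> ('a \<Rightarrow> real) \<Rightarrow> bool" where
  "continuous_rv M Y \<longleftrightarrow> Y \<in> borel_measurable M \<and> continuous_on UNIV (cdf (distr M borel Y))"

text \<open>The value at \<open>\<omega>\<close> of the order statistic \<open>X\<^sub>j\<^sub>:\<^sub>n\<close>, for \<open>1 \<le> j \<le> n\<close>.\<close>

definition order_stat :: "(nat \<Rightarrow> 'a \<Rightarrow> real) \<Rightarrow> nat \<Rightarrow> nat \<Rightarrow> 'a \<Rightarrow> real" where
  "order_stat X n j \<omega> = sort (map (\<lambda>i. X i \<omega>) [1..<Suc n]) ! (j - 1)"

definition max_over :: "(nat \<Rightarrow> 'a \<Rightarrow> real) \<Rightarrow> nat set \<Rightarrow> 'a \<Rightarrow> real" where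
  "max_over X I \<omega> = Max ((\<lambda>i. X i \<omega>) ` I)"

definition max_cdf :: "'a measure \<Rightarrow> (nat \<Rightarrow> 'a \<Rightarrow> real) \<Rightarrow> nat set \<Rightarrow> real \<Rightarrow> real" where
  "max_cdf M X I x = measure M {\<omega> \<in> space M. max_over X I \<omega> \<le> x}"

text \<open>A function of the variables \<open>(x\<^sub>i)\<close>, \<open>i \<in> J\<close>, is a function on the extensional functions
  \<open>J \<rightarrow>\<^sub>E UNIV\<close>.\<close>

definition coord_nondecreasing :: "nat set \<Rightarrow> ((nat \<Rightarrow> real) \<Rightarrow> real) \<Rightarrow> bool" where
  "coord_nondecreasing J \<phi> \<longleftrightarrow> (\<forall>x \<in> J \<rightarrow>\<^sub>E UNIV. \<forall>i\<in>J. mono (\<lambda>t. \<phi> (x(i := t))))"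

definition coord_nonincreasing :: "nat set \<Rightarrow> ((nat \<Rightarrow> real) \<Rightarrow> real) \<Rightarrow> bool" where
  "coord_nonincreasing J \<phi> \<longleftrightarrow> (\<forall>x \<in> J \<rightarrow>\<^sub>E UNIV. \<forall>i\<in>J. antimono (\<lambda>t. \<phi> (x(i := t))))"

text \<open>\<open>g\<close> is a version of \<open>z \<mapsto> E(Y | Z = z)\<close>.\<close>

definition cond_exp_version ::
    "'a measure \<Rightarrow> ('a \<Rightarrow> real) \<Rightarrow> ('a \<Rightarrow> real) \<Rightarrow> (real \<Rightarrow> real) \<Rightarrow> bool" where
  "cond_exp_version M Y Z g \<longleftrightarrow>
     g \<in> borel_measurable borel \<and>
     (AE \<omega> in M. real_cond_exp M (vimage_algebra (space M) Z borel) Y \<omega> = g (Z \<omega>))"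

text \<open>Monotonicity of a version is required on a Borel set carrying the law of \<open>Z\<close>, not on the
  whole line: when \<open>Z\<close> is bounded, \<open>E(Y | Z = z)\<close> may tend to infinity at the end of the range of
  \<open>Z\<close>, and then it has no real-valued monotone extension to the line.\<close>

definition cond_exp_nondecreasing ::
    "'a measure \<Rightarrow> ('a \<Rightarrow> real) \<Rightarrow> ('a \<Rightarrow> real) \<Rightarrow> bool" where
  "cond_exp_nondecreasing M Y Z \<longleftrightarrow>
     (\<exists>g. \<exists>S\<in>sets borel. cond_exp_version M Y Z g \<and> (AE \<omega> in M. Z \<omega> \<in> S) \<and> mono_on S g)"

definition cond_exp_nonincreasing ::
    "'a measure \<Rightarrow> ('a \<Rightarrow> real) \<Rightarrow> ('a \<Rightarrow> real) \<Rightarrow> bool" where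
  "cond_exp_nonincreasing M Y Z \<longleftrightarrow>
     (\<exists>g. \<exists>S\<in>sets borel. cond_exp_version M Y Z g \<and> (AE \<omega> in M. Z \<omega> \<in> S) \<and> antimono_on S g)"

text \<open>The vector \<open>X\<^sup>-\<^sup>I\<close> of the variables outside \<open>I\<close> keeps its original indices, so \<open>\<phi>\<close> is a
  function of the coordinates in \<open>{1..n} - I\<close>. As usual, \<open>\<phi>\<close> is Borel.\<close>

definition condition_A :: "'a measure \<Rightarrow> (nat \<Rightarrow> 'a \<Rightarrow> real) \<Rightarrow> nat \<Rightarrow> nat \<Rightarrow> bool" where
  "condition_A M X n k \<longleftrightarrow>
     (\<forall>I \<phi>. I \<subseteq> {1..n} \<and> card I = k \<and>
        \<phi> \<in> borel_measurable (PiM ({1..n} - I) (\<lambda>_. borel)) \<and>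
        integrable M (\<lambda>\<omega>. \<phi> (\<lambda>i\<in>{1..n} - I. X i \<omega>)) \<longrightarrow>
        (coord_nondecreasing ({1..n} - I) \<phi> \<longrightarrow>
          cond_exp_nondecreasing M (\<lambda>\<omega>. \<phi> (\<lambda>i\<in>{1..n} - I. X i \<omega>)) (max_over X I)) \<and>
        (coord_nonincreasing ({1..n} - I) \<phi> \<longrightarrow>
          cond_exp_nonincreasing M (\<lambda>\<omega>. \<phi> (\<lambda>i\<in>{1..n} - I. X i \<omega>)) (max_over X I)))"

end

theory Submission
  imports Defs
begin

text \<open>
  Let \<open>R\<close> be the largest \<open>j\<close> with \<open>X\<^sub>j\<^sub>:\<^sub>n < a\<^sub>j\<close>. If \<open>R = j\<close>, then exactly \<open>j\<close> of the variables lie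
  below \<open>a\<^sub>j\<close>, so that exactly \<open>j choose k\<close> of the sets \<open>I\<close> satisfy \<open>max\<^sub>I X < a\<^sub>j\<close>; hence
  \<open>P(R exists)\<close> is the sum over \<open>I\<close> and \<open>j\<close> of \<open>P(max\<^sub>I X < a\<^sub>j, R = j) / (j choose k)\<close>. On
  \<open>max\<^sub>I X < a\<^sub>j\<close> the event \<open>R = j\<close> is a difference \<open>D\<^sub>j - D\<^sub>j\<^sub>-\<^sub>1\<close> of nested increasing events in the
  variables outside \<open>I\<close>. Summation by parts leaves the term \<open>F\<^sub>I(a\<^sub>n) / (n choose k)\<close> plus the
  differences of \<open>P(D\<^sub>j | max\<^sub>I X < t) F\<^sub>I(t) / (l choose k)\<close> between \<open>t = a\<^sub>j, l = j\<close> and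
  \<open>t = a\<^sub>j\<^sub>+\<^sub>1, l = j + 1\<close>. They are nonpositive, since Condition A makes the first factor
  nondecreasing in \<open>t\<close>, and vanish under independence with constant ratios.
\<close>

section \<open>Order statistics as counts, and basic properties of the events
  \<open>clears\<close>\<close>

text \<open>The entries below \<open>c\<close> form an initial segment of a sorted list. This turns
  order statistics into counts, which do not depend on the order of the entries.\<close>

lemma sorted_nth_less_iff:
  fixes xs :: "'a::linorder list"
  assumes "sorted xs" "j < length xs"
  shows "xs ! j < c \<longleftrightarrow> j < length (filter (\<lambda>x. x < c) xs)"
  using assms
proof (induction xs arbitrary: j)
  case (Cons x xs)
  show ?case
  proof (cases "x < c")
    case True
    then show ?thesis using Cons by (cases j) auto
  next
    case False
    then have "filter (\<lambda>y. y < c) xs = []" "c \<le> (x # xs) ! j"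
      using Cons.prems by (auto simp: filter_empty_conv nth_Cons split: nat.split)
        (meson nth_mem le_less_trans not_le order.trans)+
    then show ?thesis using False by auto
  qed
qed simp

lemma order_stat_ge_iff:
  assumes "1 \<le> j" "j \<le> n"
  shows "order_stat X n j \<omega> \<ge> c \<longleftrightarrow> card {i \<in> {1..n}. X i \<omega> < c} < j"
proof -
  let ?xs = "map (\<lambda>i. X i \<omega>) [1..<Suc n]"
  have "length (filter (\<lambda>x. x < c) (sort ?xs)) = length (filter (\<lambda>x. x < c) ?xs)"
    by (metis mset_filter mset_sort size_mset)
  also have "\<dots> = length (filter (\<lambda>i. X i \<omega> < c) [1..<Suc n])"
    by (simp only: filter_map length_map o_def)
  also have "\<dots> = card {i \<in> {1..n}. X i \<omega> < c}"
    by (subst distinct_card[symmetric]) (auto intro!: arg_cong[where f=card])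
  finally show ?thesis
    unfolding order_stat_def using assms sorted_nth_less_iff[of "sort ?xs" "j - 1" c]
    by (auto simp del: upt_Suc simp: not_less[symmetric])
qed

text \<open>With \<open>V = {1..n} - I\<close> this is the event \<open>D\<^sub>j\<close>: for no \<open>l > j\<close> do the variables outside \<open>I\<close>,
  together with \<open>k\<close> further ones below \<open>a\<^sub>l\<close>, force \<open>X\<^sub>l\<^sub>:\<^sub>n < a\<^sub>l\<close>.\<close>

definition clears :: "nat set \<Rightarrow> (nat \<Rightarrow> real) \<Rightarrow> nat \<Rightarrow> nat \<Rightarrow> nat \<Rightarrow> (nat \<Rightarrow> real) \<Rightarrow> bool" where
  "clears V a k n j x \<longleftrightarrow> (\<forall>l\<in>{j<..n}. card {i \<in> V. x i < a l} + k < l)"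

lemma clears_top: "clears V a k n n x"
  by (simp add: clears_def)

text \<open>The requirement at \<open>l = k\<close> would force a count to be negative. This makes
  the lower boundary term of the later summation by parts vanish.\<close>

lemma not_clears_bot: "1 \<le> k \<Longrightarrow> k \<le> n \<Longrightarrow> \<not> clears V a k n (k - 1) x"
  by (auto simp: clears_def intro!: bexI[of _ k])

text \<open>Only coordinates in \<open>V\<close> are counted, so the event is a function of the
  restricted vector on which Condition A and independence of blocks operate.\<close>

lemma clears_restrict [simp]: "clears V a k n j (restrict x V) = clears V a k n j x"
proof -
  have "{i \<in> V. restrict x V i < c} = {i \<in> V. x i < c}" for c by auto
  then show ?thesis by (simp add: clears_def)
qed

lemma clears_pred:
  assumes "1 \<le> j" "j \<le> n"
  shows "clears V a k n (j - 1) x \<longleftrightarrow> clears V a k n j x \<and> card {i \<in> V. x i < a j} + k < j"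
proof -
  have "{j - 1<..n} = insert j {j<..n}" using assms by auto
  then show ?thesis by (auto simp: clears_def)
qed

text \<open>Raising coordinates can only shrink each count. Hence the indicator of the event is an
  admissible nondecreasing function in Condition A.\<close>

lemma clears_mono:
  assumes "finite V" "\<And>i. i \<in> V \<Longrightarrow> x i \<le> y i" "clears V a k n j x"
  shows "clears V a k n j y"
  unfolding clears_def
proof
  fix l assume l: "l \<in> {j<..n}"
  have "card {i \<in> V. y i < a l} \<le> card {i \<in> V. x i < a l}"
    using assms(1,2) by (intro card_mono) (auto intro: le_less_trans)
  then show "card {i \<in> V. y i < a l} + k < l"
    using assms(3) l by (auto simp: clears_def dest!: bspec[OF _ l])
qed

lemma coord_nondecreasing_clears:
  "finite V \<Longrightarrow> coord_nondecreasing V (\<lambda>x. of_bool (clears V a k n j x))"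
  unfolding coord_nondecreasing_def by (auto intro!: monoI elim!: clears_mono[rotated 2])

section \<open>Measurability\<close>

lemma measurable_card_below:
  fixes X :: "nat \<Rightarrow> 'a \<Rightarrow> real"
  assumes X: "\<And>i. i \<in> V \<Longrightarrow> X i \<in> borel_measurable M"
  shows "(\<lambda>\<omega>. card {i \<in> V. X i \<omega> < c}) \<in> measurable M (count_space UNIV)"
proof (rule measurable_card)
  fix i
  show "{\<omega> \<in> space M. i \<in> {i \<in> V. X i \<omega> < c}} \<in> sets M"
    using X[of i] by (cases "i \<in> V") auto
qed

lemma pred_all_less:
  fixes X :: "nat \<Rightarrow> 'a \<Rightarrow> real"
  assumes "finite I" "\<And>i. i \<in> I \<Longrightarrow> X i \<in> borel_measurable M"
  shows "Measurable.pred M (\<lambda>\<omega>. \<forall>i\<in>I. X i \<omega> < c)"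
proof -
  note [measurable] = assms
  show ?thesis by measurable
qed

lemma pred_clears:
  fixes X :: "nat \<Rightarrow> 'a \<Rightarrow> real"
  assumes "\<And>i. i \<in> V \<Longrightarrow> X i \<in> borel_measurable M"
  shows "Measurable.pred M (\<lambda>\<omega>. clears V a k n j (\<lambda>i. X i \<omega>))"
proof -
  note [measurable] = measurable_card_below[OF assms]
  show ?thesis unfolding clears_def by measurable
qed

lemma measurable_clears [measurable]: "Measurable.pred (PiM V (\<lambda>_. borel)) (clears V a k n j)"
  using pred_clears[of V "\<lambda>i x. x i" "PiM V (\<lambda>_. borel)"] by simp

section \<open>The counting identity at a single point\<close>

text \<open>For fixed \<open>j\<close> the terms over all \<open>I\<close> add up to the indicator
  of \<open>L j\<close>, and \<open>L j\<close> holds for at most one \<open>j\<close>. No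
  probability enters, so taking expectations later needs only linearity.\<close>

lemma exists_below_eq_sum:
  fixes x a :: "nat \<Rightarrow> real"
  assumes k: "1 \<le> k" and a: "mono_on {k..n} a"
  shows "of_bool (\<exists>j\<in>{k..n}. j \<le> card {i \<in> {1..n}. x i < a j}) =
    (\<Sum>I | I \<subseteq> {1..n} \<and> card I = k. \<Sum>j=k..n.
       (of_bool ((\<forall>i\<in>I. x i < a j) \<and> clears ({1..n} - I) a k n j x)
        - of_bool ((\<forall>i\<in>I. x i < a j) \<and> clears ({1..n} - I) a k n (j - 1) x)) / real (j choose k))"
proof -
  define N where "N j = card {i \<in> {1..n}. x i < a j}" for j
  \<comment> \<open>\<open>L j\<close> says that \<open>j\<close> is the last index whose order
    statistic lies below its bound, the event \<open>R = j\<close>.\<close>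
  define L where "L j \<longleftrightarrow> j \<le> N j \<and> (\<forall>l\<in>{j<..n}. N l < l)" for j
  have N_le: "N j \<le> n" for j
    unfolding N_def by (rule order.trans[OF card_mono[of "{1..n}"]]) auto
  have N_mono: "N j \<le> N l" if "k \<le> j" "j \<le> l" "l \<le> n" for j l
    unfolding N_def using that mono_onD[OF a, of j l] by (intro card_mono) auto
  \<comment> \<open>The count cannot exceed \<open>j\<close>: it is at most
    \<open>N (Suc j)\<close>, because \<open>a\<close> is nondecreasing, and \<open>L j\<close>
    makes the latter less than \<open>Suc j\<close>. For \<open>j = n\<close> there are only
    \<open>n\<close> variables.\<close>
  have N_eq: "N j = j" if "L j" "j \<in> {k..n}" for j
  proof (cases "j = n")
    case True
    then show ?thesis using that N_le[of j] by (simp add: L_def)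
  next
    case False
    then have "N (Suc j) < Suc j" "N j \<le> N (Suc j)"
      using that N_mono[of j "Suc j"] by (auto simp: L_def)
    then show ?thesis using that by (simp add: L_def)
  qed
  \<comment> \<open>Once all of \<open>I\<close> lies below \<open>a j\<close>, it also lies below
    every later \<open>a l\<close>, so the \<open>k\<close> added in \<open>clears\<close> is
    exactly the contribution of \<open>I\<close>.\<close>
  have N_split: "card {i \<in> {1..n} - I. x i < a l} + k = N l"
    if I: "I \<subseteq> {1..n}" "card I = k" and "\<forall>i\<in>I. x i < a j" "k \<le> j" "j \<le> l" "l \<le> n" for I j l
  proof -
    have "a j \<le> a l" using that mono_onD[OF a, of j l] by auto
    then have "{i \<in> {1..n}. x i < a l} = {i \<in> {1..n} - I. x i < a l} \<union> I"
      using that by force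
    moreover have "finite I" using I finite_subset by blast
    ultimately show ?thesis unfolding N_def using I(2)
      by (subst \<open>{i \<in> {1..n}. x i < a l} = _\<close>, subst card_Un_disjoint) auto
  qed
  \<comment> \<open>The two events are nested and differ by the requirement at \<open>l = j\<close>,
    which here reads \<open>N j < j\<close>; its failure is the first half of
    \<open>L j\<close>.\<close>
  have diff: "of_bool ((\<forall>i\<in>I. x i < a j) \<and> clears ({1..n} - I) a k n j x)
      - of_bool ((\<forall>i\<in>I. x i < a j) \<and> clears ({1..n} - I) a k n (j - 1) x)
      = (of_bool ((\<forall>i\<in>I. x i < a j) \<and> L j) :: real)"
    if "I \<subseteq> {1..n}" "card I = k" "j \<in> {k..n}" for I j
  proof (cases "\<forall>i\<in>I. x i < a j")
    case True
    have "clears ({1..n} - I) a k n j x \<longleftrightarrow> (\<forall>l\<in>{j<..n}. N l < l)"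
      unfolding clears_def using N_split[OF that(1,2) True] that(3) by (intro ball_cong) auto
    moreover have "clears ({1..n} - I) a k n (j - 1) x \<longleftrightarrow>
        clears ({1..n} - I) a k n j x \<and> N j < j"
      using clears_pred[of j n] that(3) k N_split[OF that(1,2) True, of j] by auto
    ultimately show ?thesis using True by (auto simp: L_def)
  next
    case False
    then show ?thesis by (simp only: simp_thms of_bool_eq diff_self)
  qed
  have count: "(\<Sum>I | I \<subseteq> {1..n} \<and> card I = k. of_bool ((\<forall>i\<in>I. x i < a j) \<and> L j) / real (j choose k))
      = of_bool (L j)" if j: "j \<in> {k..n}" for j
  proof (cases "L j")
    case True
    let ?S = "{I. I \<subseteq> {1..n} \<and> card I = k}"
    have fin: "finite ?S" by (rule finite_subset[of _ "Pow {1..n}"]) auto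
    have "(\<Sum>I\<in>?S. of_bool ((\<forall>i\<in>I. x i < a j) \<and> L j)) = real (card {I \<in> ?S. \<forall>i\<in>I. x i < a j})"
      using True fin by (simp add: sum.If_cases of_bool_def Int_def)
    also have "{I \<in> ?S. \<forall>i\<in>I. x i < a j} = {I. I \<subseteq> {i \<in> {1..n}. x i < a j} \<and> card I = k}"
      by auto
    also have "card \<dots> = j choose k"
      using N_eq[OF True j] by (subst n_subsets) (auto simp: N_def)
    finally show ?thesis using True j by (simp add: sum_divide_distrib[symmetric])
  qed simp
  \<comment> \<open>The only index that can satisfy \<open>L\<close> is the maximum of those with
    \<open>j \<le> N j\<close>.\<close>
  have "(\<Sum>j=k..n. of_bool (L j)) = (of_bool (\<exists>j\<in>{k..n}. j \<le> N j) :: real)"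
  proof (cases "\<exists>j\<in>{k..n}. j \<le> N j")
    case True
    define m where "m = Max {j \<in> {k..n}. j \<le> N j}"
    have m: "m \<in> {j \<in> {k..n}. j \<le> N j}"
      unfolding m_def using True by (intro Max_in) auto
    have le: "j \<le> m" if "j \<in> {k..n}" "j \<le> N j" for j
      unfolding m_def using that by (intro Max_ge) auto
    have "L j \<longleftrightarrow> j = m" if "j \<in> {k..n}" for j
    proof
      assume "L j"
      then have "j \<le> m" using le that by (simp add: L_def)
      moreover have "\<not> j < m" using m \<open>L j\<close> by (force simp: L_def not_le[symmetric])
      ultimately show "j = m" by simp
    next
      assume "j = m"
      have "N l < l" if "l \<in> {m<..n}" for l
        using le[of l] m that by (cases "N l < l") auto
      then show "L j" using m \<open>j = m\<close> by (simp add: L_def)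
    qed
    then have "(\<Sum>j=k..n. of_bool (L j)) = (\<Sum>j=k..n. of_bool (j = m) :: real)"
      by (intro sum.cong) auto
    also have "\<dots> = 1" using m by (simp add: of_bool_def)
    finally show ?thesis using True by simp
  qed (auto simp: L_def)
  then have "of_bool (\<exists>j\<in>{k..n}. j \<le> N j) =
      (\<Sum>j=k..n. \<Sum>I | I \<subseteq> {1..n} \<and> card I = k.
         of_bool ((\<forall>i\<in>I. x i < a j) \<and> L j) / real (j choose k))"
    using count by simp
  also have "\<dots> = (\<Sum>I | I \<subseteq> {1..n} \<and> card I = k. \<Sum>j=k..n.
         of_bool ((\<forall>i\<in>I. x i < a j) \<and> L j) / real (j choose k))"
    by (rule sum.swap)
  also have "\<dots> = (\<Sum>I | I \<subseteq> {1..n} \<and> card I = k. \<Sum>j=k..n.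
       (of_bool ((\<forall>i\<in>I. x i < a j) \<and> clears ({1..n} - I) a k n j x)
        - of_bool ((\<forall>i\<in>I. x i < a j) \<and> clears ({1..n} - I) a k n (j - 1) x)) / real (j choose k))"
    by (intro sum.cong refl arg_cong2[where f = "(/)"] diff[symmetric]) auto
  finally show ?thesis unfolding N_def .
qed


section \<open>Summation by parts\<close>

text \<open>In \<open>p j m\<close>, \<open>j\<close> will index the threshold and \<open>m\<close>
  the event. Terms with equal \<open>m\<close> are paired, so each difference compares one event at
  two successive thresholds.\<close>

lemma sum_telescope_by_parts:
  fixes p :: "nat \<Rightarrow> nat \<Rightarrow> real"
  assumes "1 \<le> k" "k \<le> n"
  shows "(\<Sum>j=k..n. (p j j - p j (j - 1)) / c j) =
    p n n / c n - p k (k - 1) / c k + (\<Sum>j=k..<n. p j j / c j - p (Suc j) j / c (Suc j))"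
  using assms(2)
proof (induction n rule: dec_induct)
  case (step n)
  then show ?case by (simp add: diff_divide_distrib)
qed (simp add: diff_divide_distrib)

section \<open>Monotone conditional expectations\<close>

context prob_space
begin

text \<open>This is E(Y | Z < s) \<le> E(Y | Z < t), multiplied out so that it also makes sense for
  null events. The average of a nondecreasing function over \<open>Z < s\<close> cannot exceed its
  average over \<open>s \<le> Z < t\<close>.\<close>

lemma cond_exp_nondecreasing_set_integral_le:
  assumes Y: "integrable M Y" and Z [measurable]: "Z \<in> borel_measurable M"
    and mono: "cond_exp_nondecreasing M Y Z" and st: "s \<le> t"
  shows "(LINT \<omega>:{\<omega> \<in> space M. Z \<omega> < s}|M. Y \<omega>) * prob {\<omega> \<in> space M. Z \<omega> < t}
    \<le> (LINT \<omega>:{\<omega> \<in> space M. Z \<omega> < t}|M. Y \<omega>) * prob {\<omega> \<in> space M. Z \<omega> < s}"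
proof -
  define F where "F = vimage_algebra (space M) Z borel"
  have "subalgebra M F"
    unfolding subalgebra_def F_def using Z by (auto simp: sets_vimage_algebra2 measurable_sets)
  then interpret finite_measure_subalgebra M F by unfold_locales
  obtain g S where g [measurable]: "g \<in> borel_measurable borel"
    and ce: "AE \<omega> in M. real_cond_exp M F Y \<omega> = g (Z \<omega>)"
    and S: "AE \<omega> in M. Z \<omega> \<in> S" and g_mono: "mono_on S g"
    using mono unfolding cond_exp_nondecreasing_def cond_exp_version_def F_def by blast
  define A where "A = {\<omega> \<in> space M. Z \<omega> < s}"
  define B where "B = {\<omega> \<in> space M. s \<le> Z \<omega> \<and> Z \<omega> < t}"
  have [measurable]: "A \<in> sets M" "B \<in> sets M" by (auto simp: A_def B_def)
  have int: "integrable M (\<lambda>\<omega>. g (Z \<omega>))"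
    using integrable_cong_AE[of "real_cond_exp M F Y" M "\<lambda>\<omega>. g (Z \<omega>)"] ce real_cond_exp_int(1)[OF Y]
    by (auto intro: borel_measurable_integrable)
  have eq: "(LINT \<omega>:{\<omega> \<in> space M. Z \<omega> \<in> T}|M. Y \<omega>) = (LINT \<omega>:{\<omega> \<in> space M. Z \<omega> \<in> T}|M. g (Z \<omega>))"
    if [measurable]: "T \<in> sets borel" for T
  proof -
    have "{\<omega> \<in> space M. Z \<omega> \<in> T} \<in> sets F"
      using that by (auto simp: F_def sets_vimage_algebra2)
    then have "(LINT \<omega>:{\<omega> \<in> space M. Z \<omega> \<in> T}|M. Y \<omega>)
        = (LINT \<omega>:{\<omega> \<in> space M. Z \<omega> \<in> T}|M. real_cond_exp M F Y \<omega>)"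
      by (rule real_cond_exp_intA[OF Y])
    also have "\<dots> = (LINT \<omega>:{\<omega> \<in> space M. Z \<omega> \<in> T}|M. g (Z \<omega>))"
      using ce by (intro set_lebesgue_integral_cong_AE) auto
    finally show ?thesis .
  qed
  have eqA: "(LINT \<omega>:A|M. Y \<omega>) = (LINT \<omega>:A|M. g (Z \<omega>))"
    using eq[of "{..<s}"] by (simp add: A_def)
  have eqB: "(LINT \<omega>:B|M. Y \<omega>) = (LINT \<omega>:B|M. g (Z \<omega>))"
    using eq[of "{s..<t}"] by (simp add: B_def)
  have si: "set_integrable M A (\<lambda>\<omega>. g (Z \<omega>))" "set_integrable M B (\<lambda>\<omega>. g (Z \<omega>))"
    unfolding set_integrable_def by (rule integrable_mult_indicator[OF _ int]; measurable)+
  have siY: "set_integrable M A Y" "set_integrable M B Y"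
    unfolding set_integrable_def by (rule integrable_mult_indicator[OF _ Y]; measurable)+
  have null: "(LINT \<omega>:C|M. Y \<omega>) = 0" if "C \<in> sets M" "prob C = 0" for C
  proof -
    have "AE \<omega> in M. \<omega> \<notin> C" using that prob_eq_0[of C] by simp
    then have "AE \<omega> in M. indicator C \<omega> *\<^sub>R Y \<omega> = 0" by eventually_elim simp
    then show ?thesis unfolding set_lebesgue_integral_def by (rule integral_eq_zero_AE)
  qed
  \<comment> \<open>Adding the integral over \<open>A\<close> times \<open>prob A\<close> to both
    sides gives the claim, since \<open>Z < t\<close> is the disjoint union of \<open>A\<close> and
    \<open>B\<close>.\<close>
  have key: "(LINT \<omega>:A|M. Y \<omega>) * prob B \<le> (LINT \<omega>:B|M. Y \<omega>) * prob A"
  proof (cases "prob A = 0 \<or> prob B = 0")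
    case True
    then show ?thesis using null[of A] null[of B] by auto
  next
    case False
    have nonempty: "\<exists>\<omega>\<in>C. Z \<omega> \<in> S" if "prob C \<noteq> 0" "C \<in> sets M" for C
    proof (rule ccontr)
      assume none: "\<not> (\<exists>\<omega>\<in>C. Z \<omega> \<in> S)"
      from S have "AE \<omega> in M. \<omega> \<notin> C" by eventually_elim (use none in blast)
      then show False using that prob_eq_0[of C] by simp
    qed
    \<comment> \<open>\<open>Sup G\<close> separates the values of \<open>g (Z \<omega>)\<close> on
      \<open>A\<close> from those on \<open>B\<close>, almost everywhere. The version is monotone
      only on \<open>S\<close>, so points of \<open>S\<close> are needed: \<open>\<alpha>\<close>
      makes \<open>G\<close> nonempty and \<open>\<beta>\<close> bounds it above.\<close>
    define G where "G = g ` (S \<inter> {..<s})"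
    obtain \<alpha> where \<alpha>: "\<alpha> \<in> A" "Z \<alpha> \<in> S" using nonempty[of A] False by auto
    obtain \<beta> where \<beta>: "\<beta> \<in> B" "Z \<beta> \<in> S" using nonempty[of B] False by auto
    have le: "y \<le> g z" if "y \<in> G" "z \<in> S" "s \<le> z" for y z
      using that g_mono by (auto simp: G_def mono_on_def)
    have "G \<noteq> {}" using \<alpha> by (auto simp: G_def A_def)
    moreover have "bdd_above G" using le[of _ "Z \<beta>"] \<beta> unfolding bdd_above_def by (auto simp: B_def)
    ultimately have lo: "g z \<le> Sup G" if "z \<in> S" "z < s" for z
      using that by (intro cSup_upper) (auto simp: G_def)
    have hi: "Sup G \<le> g z" if "z \<in> S" "s \<le> z" for z
      using that \<open>G \<noteq> {}\<close> le by (intro cSup_least) auto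
    have const: "set_integrable M C (\<lambda>_. Sup G)" if "C \<in> sets M" for C
      unfolding set_integrable_def using that by (intro integrable_mult_indicator) auto
    have "AE \<omega> in M. \<omega> \<in> A \<longrightarrow> g (Z \<omega>) \<le> Sup G"
      using S by eventually_elim (simp add: A_def lo)
    then have "(LINT \<omega>:A|M. g (Z \<omega>)) \<le> (LINT \<omega>:A|M. Sup G)"
      using si(1) const by (intro set_integral_mono_AE) auto
    moreover have "AE \<omega> in M. \<omega> \<in> B \<longrightarrow> Sup G \<le> g (Z \<omega>)"
      using S by eventually_elim (simp add: B_def hi)
    then have "(LINT \<omega>:B|M. Sup G) \<le> (LINT \<omega>:B|M. g (Z \<omega>))"
      using si(2) const by (intro set_integral_mono_AE) auto
    ultimately have "(LINT \<omega>:A|M. Y \<omega>) \<le> Sup G * prob A" "Sup G * prob B \<le> (LINT \<omega>:B|M. Y \<omega>)"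
      unfolding eqA eqB by (simp_all add: set_integral_const mult.commute)
    then have "(LINT \<omega>:A|M. Y \<omega>) * prob B \<le> Sup G * prob A * prob B"
      "Sup G * prob B * prob A \<le> (LINT \<omega>:B|M. Y \<omega>) * prob A"
      by (auto intro: mult_right_mono)
    then show ?thesis by (simp add: mult_ac)
  qed
  have AB: "{\<omega> \<in> space M. Z \<omega> < t} = A \<union> B" "A \<inter> B = {}"
    using st by (auto simp: A_def B_def)
  have "prob (A \<union> B) = prob A + prob B"
    using AB(2) by (intro finite_measure_Union) auto
  moreover have "(LINT \<omega>:A \<union> B|M. Y \<omega>) = (LINT \<omega>:A|M. Y \<omega>) + (LINT \<omega>:B|M. Y \<omega>)"
    using AB(2) siY by (rule set_integral_Un)
  ultimately show ?thesis using key AB(1) by (simp add: A_def[symmetric] algebra_simps)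
qed

section \<open>Indicators, absence of atoms, and the expected counting identity\<close>

lemma prob_eq_expectation_of_bool:
  assumes [measurable]: "Measurable.pred M P"
  shows "integrable M (\<lambda>\<omega>. of_bool (P \<omega>) :: real)"
    and "expectation (\<lambda>\<omega>. of_bool (P \<omega>)) = prob {\<omega> \<in> space M. P \<omega>}"
proof -
  have *: "of_bool (P \<omega>) = (indicator {\<omega> \<in> space M. P \<omega>} \<omega> :: real)" if "\<omega> \<in> space M" for \<omega>
    using that by simp
  show "integrable M (\<lambda>\<omega>. of_bool (P \<omega>) :: real)"
    by (subst Bochner_Integration.integrable_cong[OF refl *]) (auto simp: emeasure_eq_measure intro!: integrable_real_indicator)
  show "expectation (\<lambda>\<omega>. of_bool (P \<omega>)) = prob {\<omega> \<in> space M. P \<omega>}"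
    by (subst Bochner_Integration.integral_cong[OF refl *]) auto
qed

lemma set_integral_of_bool:
  assumes [measurable]: "Measurable.pred M P" "Measurable.pred M Q"
  shows "(LINT \<omega>:{\<omega> \<in> space M. P \<omega>}|M. of_bool (Q \<omega>)) = prob {\<omega> \<in> space M. P \<omega> \<and> Q \<omega>}"
proof -
  have "(LINT \<omega>:{\<omega> \<in> space M. P \<omega>}|M. of_bool (Q \<omega>)) = expectation (\<lambda>\<omega>. of_bool (P \<omega> \<and> Q \<omega>))"
    unfolding set_lebesgue_integral_def by (intro Bochner_Integration.integral_cong) auto
  also have "\<dots> = prob {\<omega> \<in> space M. P \<omega> \<and> Q \<omega>}"
    by (rule prob_eq_expectation_of_bool(2)) measurable
  finally show ?thesis .
qed

text \<open>An atom at \<open>c\<close> would be a jump of the distribution function there.\<close>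

lemma continuous_rv_AE_neq:
  assumes "continuous_rv M Y"
  shows "AE \<omega> in M. Y \<omega> \<noteq> c"
proof -
  have [measurable]: "Y \<in> borel_measurable M" using assms by (simp add: continuous_rv_def)
  interpret D: prob_space "distr M borel Y" by (rule prob_space_distr) simp
  interpret D: real_distribution "distr M borel Y" by unfold_locales auto
  have "isCont (cdf (distr M borel Y)) c"
    using assms by (simp add: continuous_rv_def continuous_on_eq_continuous_at)
  then have "prob (Y -` {c} \<inter> space M) = 0"
    by (simp add: D.isCont_cdf measure_distr)
  moreover have "Y -` {c} \<inter> space M = {\<omega> \<in> space M. \<not> Y \<omega> \<noteq> c}" by auto
  ultimately show ?thesis
    by (subst AE_iff_measurable[OF _ refl]) (auto simp: emeasure_eq_measure)
qed

text \<open>The distribution function uses a weak inequality and the counting a strict one;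
  continuity makes the difference a null event.\<close>

lemma max_cdf_eq:
  assumes X: "\<And>i. i \<in> I \<Longrightarrow> continuous_rv M (X i)" and I: "finite I" "I \<noteq> {}"
  shows "max_cdf M X I c = prob {\<omega> \<in> space M. \<forall>i\<in>I. X i \<omega> < c}"
proof -
  have [measurable]: "i \<in> I \<Longrightarrow> X i \<in> borel_measurable M" for i
    using X by (simp add: continuous_rv_def)
  note [measurable] = I(1)
  have "AE \<omega> in M. \<forall>i\<in>I. X i \<omega> \<noteq> c"
    using X I(1) by (intro AE_finite_allI continuous_rv_AE_neq) auto
  then have "prob {\<omega> \<in> space M. \<forall>i\<in>I. X i \<omega> \<le> c} = prob {\<omega> \<in> space M. \<forall>i\<in>I. X i \<omega> < c}"
    by (intro finite_measure_eq_AE) (auto elim!: eventually_mono simp: less_le)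
  then show ?thesis
    unfolding max_cdf_def max_over_def using I by simp
qed

text \<open>The pointwise identity is integrated term by term. Threshold index and event index are
  kept separate in \<open>p\<close> to prepare the summation by parts.\<close>

lemma prob_exists_below:
  assumes k: "1 \<le> k" and a: "mono_on {k..n} a"
    and X: "\<And>i. i \<in> {1..n} \<Longrightarrow> X i \<in> borel_measurable M"
    and p_def: "\<And>I j m. p I j m = prob {\<omega> \<in> space M. (\<forall>i\<in>I. X i \<omega> < a j) \<and>
        clears ({1..n} - I) a k n m (\<lambda>i. X i \<omega>)}"
  shows "prob {\<omega> \<in> space M. \<exists>j\<in>{k..n}. j \<le> card {i \<in> {1..n}. X i \<omega> < a j}} =
    (\<Sum>I | I \<subseteq> {1..n} \<and> card I = k. \<Sum>j=k..n. (p I j j - p I j (j - 1)) / real (j choose k))"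
proof -
  define Q where "Q I j m \<omega> \<longleftrightarrow> (\<forall>i\<in>I. X i \<omega> < a j) \<and> clears ({1..n} - I) a k n m (\<lambda>i. X i \<omega>)"
    for I j m \<omega>
  define d :: "nat set \<Rightarrow> nat \<Rightarrow> 'a \<Rightarrow> real"
    where "d I j \<omega> = (of_bool (Q I j j \<omega>) - of_bool (Q I j (j - 1) \<omega>)) / real (j choose k)" for I j \<omega>
  let ?Is = "{I. I \<subseteq> {1..n} \<and> card I = k}"
  have Q: "Measurable.pred M (Q I j m)" if "I \<subseteq> {1..n}" for I j m
    unfolding Q_def using that X finite_subset[OF that]
    by (intro pred_intros_logic pred_clears pred_all_less) auto
  have d_int: "integrable M (d I j)" if "I \<subseteq> {1..n}" for I j
    unfolding d_def using prob_eq_expectation_of_bool(1)[OF Q[OF that]] by simp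
  have d_exp: "expectation (d I j) = (p I j j - p I j (j - 1)) / real (j choose k)"
    if "I \<subseteq> {1..n}" for I j
    unfolding d_def p_def Q_def[symmetric]
    using prob_eq_expectation_of_bool[OF Q[OF that]] by simp
  note [measurable] = measurable_card_below[OF X]
  have "Measurable.pred M (\<lambda>\<omega>. \<exists>j\<in>{k..n}. j \<le> card {i \<in> {1..n}. X i \<omega> < a j})"
    by measurable
  then have "prob {\<omega> \<in> space M. \<exists>j\<in>{k..n}. j \<le> card {i \<in> {1..n}. X i \<omega> < a j}}
    = expectation (\<lambda>\<omega>. of_bool (\<exists>j\<in>{k..n}. j \<le> card {i \<in> {1..n}. X i \<omega> < a j}))"
    by (rule prob_eq_expectation_of_bool(2)[symmetric])
  also have "\<dots> = expectation (\<lambda>\<omega>. \<Sum>I\<in>?Is. \<Sum>j=k..n. d I j \<omega>)"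
    unfolding exists_below_eq_sum[OF k a] d_def Q_def ..
  also have "\<dots> = (\<Sum>I\<in>?Is. expectation (\<lambda>\<omega>. \<Sum>j=k..n. d I j \<omega>))"
    by (rule Bochner_Integration.integral_sum) (simp add: d_int)
  also have "\<dots> = (\<Sum>I\<in>?Is. \<Sum>j=k..n. (p I j j - p I j (j - 1)) / real (j choose k))"
    by (intro sum.cong refl, subst Bochner_Integration.integral_sum) (auto simp: d_int d_exp)
  finally show ?thesis .
qed

section \<open>Comparing thresholds under Condition A and under independence\<close>

text \<open>Given that the maximum over \<open>I\<close> is below a threshold, the conditional
  probability of the increasing event \<open>clears\<close> grows with the threshold. The inequality
  is multiplied out to cover null events.\<close>

lemma prob_below_clears_step:
  assumes k: "1 \<le> k" and X: "\<And>i. i \<in> {1..n} \<Longrightarrow> X i \<in> borel_measurable M"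
    and A: "condition_A M X n k" and I: "I \<subseteq> {1..n}" "card I = k" and st: "s \<le> t"
  shows "prob {\<omega> \<in> space M. (\<forall>i\<in>I. X i \<omega> < s) \<and> clears ({1..n} - I) a k n m (\<lambda>i. X i \<omega>)}
      * prob {\<omega> \<in> space M. \<forall>i\<in>I. X i \<omega> < t}
    \<le> prob {\<omega> \<in> space M. (\<forall>i\<in>I. X i \<omega> < t) \<and> clears ({1..n} - I) a k n m (\<lambda>i. X i \<omega>)}
      * prob {\<omega> \<in> space M. \<forall>i\<in>I. X i \<omega> < s}"
proof -
  let ?V = "{1..n} - I"
  have fin: "finite I" using I(1) finite_subset by blast
  have ne: "I \<noteq> {}" using k I(2) by auto
  have [measurable]: "Measurable.pred M (\<lambda>\<omega>. clears ?V a k n m (\<lambda>i. X i \<omega>))"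
    using X by (intro pred_clears) auto
  have Z [measurable]: "max_over X I \<in> borel_measurable M"
    unfolding max_over_def using X I fin by (intro borel_measurable_Max) auto
  have max_less: "max_over X I \<omega> < c \<longleftrightarrow> (\<forall>i\<in>I. X i \<omega> < c)" for \<omega> c
    unfolding max_over_def using fin ne by simp
  have [measurable]: "Measurable.pred M (\<lambda>\<omega>. \<forall>i\<in>I. X i \<omega> < c)" for c
    using X I(1) fin by (intro pred_all_less) auto
  have int: "integrable M (\<lambda>\<omega>. of_bool (clears ?V a k n m (\<lambda>i. X i \<omega>)) :: real)"
    by (rule prob_eq_expectation_of_bool(1)) measurable
  have [measurable]: "Measurable.pred (PiM ?V (\<lambda>_. borel)) (clears ?V a k n m)"
    by (rule measurable_clears)
  have "(\<lambda>x. of_bool (clears ?V a k n m x) :: real) \<in> borel_measurable (PiM ?V (\<lambda>_. borel))"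
    by measurable
  \<comment> \<open>Condition A is applied with \<open>\<phi>\<close> the indicator of
    \<open>clears\<close>; \<open>clears_restrict\<close> removes the restriction to the variables
    outside \<open>I\<close>.\<close>
  then have "cond_exp_nondecreasing M (\<lambda>\<omega>. of_bool (clears ?V a k n m (\<lambda>i. X i \<omega>))) (max_over X I)"
    using A[unfolded condition_A_def, rule_format, of I "\<lambda>x. of_bool (clears ?V a k n m x)"] I int
    by (simp add: coord_nondecreasing_clears)
  from cond_exp_nondecreasing_set_integral_le[OF int Z this st]
  show ?thesis unfolding max_less
    by (subst (asm) (1 2) set_integral_of_bool) measurable
qed

text \<open>The two conditions concern disjoint blocks of variables, \<open>I\<close> and its
  complement, and these blocks are independent as vectors.\<close>

lemma prob_below_clears_indep:
  assumes ind: "indep_vars (\<lambda>_. borel) X {1..n}" and I: "I \<subseteq> {1..n}"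
  shows "prob {\<omega> \<in> space M. (\<forall>i\<in>I. X i \<omega> < s) \<and> clears ({1..n} - I) a k n m (\<lambda>i. X i \<omega>)}
    = prob {\<omega> \<in> space M. \<forall>i\<in>I. X i \<omega> < s}
      * prob {\<omega> \<in> space M. clears ({1..n} - I) a k n m (\<lambda>i. X i \<omega>)}"
proof -
  let ?V = "{1..n} - I"
  have [measurable]: "finite I" "finite ?V" using I finite_subset by blast+
  define S where "S = {x \<in> space (PiM I (\<lambda>_. borel)). \<forall>i\<in>I. x i < s}"
  define T where "T = {x \<in> space (PiM ?V (\<lambda>_. borel)). clears ?V a k n m x}"
  have "S \<in> sets (PiM I (\<lambda>_. borel))" "T \<in> sets (PiM ?V (\<lambda>_. borel))"
    unfolding S_def T_def by measurable
  from indep_varD[OF indep_var_restrict[OF ind, of I ?V] this]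
  have "prob ((\<lambda>\<omega>. (restrict (\<lambda>i. X i \<omega>) I, restrict (\<lambda>i. X i \<omega>) ?V)) -` (S \<times> T) \<inter> space M)
    = prob ((\<lambda>\<omega>. restrict (\<lambda>i. X i \<omega>) I) -` S \<inter> space M)
      * prob ((\<lambda>\<omega>. restrict (\<lambda>i. X i \<omega>) ?V) -` T \<inter> space M)"
    using I by auto
  moreover have "(\<lambda>\<omega>. restrict (\<lambda>i. X i \<omega>) I) -` S = {\<omega>. \<forall>i\<in>I. X i \<omega> < s}"
    "(\<lambda>\<omega>. restrict (\<lambda>i. X i \<omega>) ?V) -` T = {\<omega>. clears ?V a k n m (\<lambda>i. X i \<omega>)}"
    "(\<lambda>\<omega>. (restrict (\<lambda>i. X i \<omega>) I, restrict (\<lambda>i. X i \<omega>) ?V)) -` (S \<times> T)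
      = {\<omega>. (\<forall>i\<in>I. X i \<omega> < s) \<and> clears ?V a k n m (\<lambda>i. X i \<omega>)}"
    by (auto simp: S_def T_def space_PiM)
  moreover have "{\<omega> \<in> space M. P \<omega>} = {\<omega>. P \<omega>} \<inter> space M" for P by auto
  ultimately show ?thesis by (simp only:)
qed

end

section \<open>Assembly of the bound and the equality case\<close>

text \<open>Here \<open>p / f\<close> and \<open>p' / f'\<close> play the role of conditional
  probabilities. Multiplying the ratio bound by \<open>p\<close> and trading \<open>p * f'\<close>
  for \<open>p' * f\<close> leaves a common factor \<open>f\<close> to cancel; if
  \<open>f = 0\<close>, then \<open>p = 0\<close>.\<close>

lemma divide_le_of_cross_mult:
  fixes p p' f f' c c' :: real
  assumes "0 < c" "0 < c'" "0 \<le> p" "p \<le> f" "0 \<le> p'"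
    and "f / c \<le> f' / c'" "p * f' \<le> p' * f"
  shows "p / c \<le> p' / c'"
proof (cases "f = 0")
  case True
  then show ?thesis using assms by simp
next
  case False
  then have "0 < f" using assms by simp
  have "p * (f / c) \<le> p * (f' / c')" using assms by (intro mult_left_mono)
  also have "\<dots> \<le> p' * f / c'" using assms by (simp add: divide_right_mono)
  finally have "p / c * f \<le> p' / c' * f" by simp
  then show ?thesis using \<open>0 < f\<close> by (rule mult_right_le_imp_le)
qed

theorem theorem2p1:
  fixes M :: "'a measure" and X :: "nat \<Rightarrow> 'a \<Rightarrow> real" and a :: "nat \<Rightarrow> real" and n k :: nat
  assumes "prob_space M"
    and "1 \<le> k" and "k \<le> n"
    and "\<And>i. i \<in> {1..n} \<Longrightarrow> continuous_rv M (X i)"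
    and "condition_A M X n k"
    and "mono_on {k..n} a"
    and "\<And>I. I \<subseteq> {1..n} \<Longrightarrow> card I = k \<Longrightarrow>
           mono_on {k..n} (\<lambda>j. max_cdf M X I (a j) / real (j choose k))"
  shows "measure M {\<omega> \<in> space M. \<forall>j\<in>{k..n}. order_stat X n j \<omega> \<ge> a j}
           \<ge> 1 - (\<Sum>I | I \<subseteq> {1..n} \<and> card I = k. max_cdf M X I (a n)) / real (n choose k)
         \<and>
         (prob_space.indep_vars M (\<lambda>_. borel) X {1..n} \<and>
          (\<forall>I. I \<subseteq> {1..n} \<and> card I = k \<longrightarrow>
             (\<lambda>j. max_cdf M X I (a j) / real (j choose k)) constant_on {k..n}) \<longrightarrow>
          measure M {\<omega> \<in> space M. \<forall>j\<in>{k..n}. order_stat X n j \<omega> \<ge> a j}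
            = 1 - (\<Sum>I | I \<subseteq> {1..n} \<and> card I = k. max_cdf M X I (a n)) / real (n choose k))"
proof -
  interpret prob_space M by fact
  have X: "X i \<in> borel_measurable M" if "i \<in> {1..n}" for i
    using assms(4)[OF that] by (simp add: continuous_rv_def)
  define Is where "Is = {I. I \<subseteq> {1..n} \<and> card I = k}"
  define C where "C j = real (j choose k)" for j
  define F where "F I j = max_cdf M X I (a j)" for I j
  define p where "p I j m = prob {\<omega> \<in> space M. (\<forall>i\<in>I. X i \<omega> < a j) \<and>
        clears ({1..n} - I) a k n m (\<lambda>i. X i \<omega>)}" for I j m
  \<comment> \<open>Both terms concern the same event \<open>clears\<close> with index
    \<open>j\<close>, first at threshold \<open>a j\<close>, then at
    \<open>a (Suc j)\<close>.\<close>
  define d where "d I j = p I j j / C j - p I (Suc j) j / C (Suc j)" for I j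
  have Is: "finite I" "I \<noteq> {}" "I \<subseteq> {1..n}" if "I \<in> Is" for I
    using that assms(2) finite_subset[of I "{1..n}"] by (auto simp: Is_def)
  have F_eq: "F I j = prob {\<omega> \<in> space M. \<forall>i\<in>I. X i \<omega> < a j}" if "I \<in> Is" for I j
    unfolding F_def using Is[OF that] assms(4) by (intro max_cdf_eq) auto
  have F_meas: "{\<omega> \<in> space M. \<forall>i\<in>I. X i \<omega> < a j} \<in> sets M" if "I \<in> Is" for I j
    using Is[OF that] X by (intro predE pred_all_less) auto
  have C_pos: "0 < C j" if "k \<le> j" for j using that by (simp add: C_def)
  let ?B = "{\<omega> \<in> space M. \<exists>j\<in>{k..n}. j \<le> card {i \<in> {1..n}. X i \<omega> < a j}}"
  note [measurable] = measurable_card_below[OF X]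
  have B_meas: "?B \<in> sets M" by measurable
  \<comment> \<open>The order statistic of index \<open>j\<close> falls below \<open>a j\<close>
    exactly when at least \<open>j\<close> variables do.\<close>
  have "{\<omega> \<in> space M. \<forall>j\<in>{k..n}. order_stat X n j \<omega> \<ge> a j} = space M - ?B"
    using assms(2) by (auto simp: order_stat_ge_iff not_le)
  then have compl: "prob {\<omega> \<in> space M. \<forall>j\<in>{k..n}. order_stat X n j \<omega> \<ge> a j} = 1 - prob ?B"
    using prob_compl[OF B_meas] by simp
  have "prob ?B = (\<Sum>I\<in>Is. \<Sum>j=k..n. (p I j j - p I j (j - 1)) / C j)"
    unfolding Is_def C_def
    by (rule prob_exists_below[where p = p and X = X, OF assms(2,6) X p_def])
  also have "\<dots> = (\<Sum>I\<in>Is. F I n / C n + (\<Sum>j=k..<n. d I j))"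
  proof (intro sum.cong refl)
    fix I assume I: "I \<in> Is"
    \<comment> \<open>Boundary terms: at the top \<open>clears\<close> imposes nothing, at the
      bottom it is impossible.\<close>
    have "p I n n = F I n" using I by (simp add: p_def F_eq clears_top)
    moreover have "p I k (k - 1) = 0"
      unfolding p_def by (simp only: not_clears_bot[OF assms(2,3)]) simp
    ultimately show "(\<Sum>j=k..n. (p I j j - p I j (j - 1)) / C j) = F I n / C n + (\<Sum>j=k..<n. d I j)"
      using sum_telescope_by_parts[OF assms(2,3), of "p I" C] by (simp add: d_def)
  qed
  also have "\<dots> = (\<Sum>I\<in>Is. F I n) / C n + (\<Sum>I\<in>Is. \<Sum>j=k..<n. d I j)"
    by (simp add: sum.distrib sum_divide_distrib)
  finally have B_eq: "prob ?B = (\<Sum>I\<in>Is. F I n) / C n + (\<Sum>I\<in>Is. \<Sum>j=k..<n. d I j)" .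
  \<comment> \<open>Condition A supplies the cross-multiplied bound, and the hypothesis on
    \<open>a\<close> the bound between the ratios of \<open>F\<close> to \<open>C\<close>.\<close>
  have "d I j \<le> 0" if I: "I \<in> Is" and j: "j \<in> {k..<n}" for I j
  proof -
    have "a j \<le> a (Suc j)" using j by (intro mono_onD[OF assms(6)]) auto
    then have cross: "p I j j * F I (Suc j) \<le> p I (Suc j) j * F I j"
      unfolding p_def F_eq[OF I] using assms(2,5) X I
      by (intro prob_below_clears_step) (auto simp: Is_def)
    have ratio: "F I j / C j \<le> F I (Suc j) / C (Suc j)"
      unfolding F_def C_def using I j by (intro mono_onD[OF assms(7)]) (auto simp: Is_def)
    have "p I j j \<le> F I j"
      unfolding p_def F_eq[OF I] by (rule finite_measure_mono[OF _ F_meas[OF I]]) auto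
    moreover have "0 \<le> p I j j" "0 \<le> p I (Suc j) j" by (simp_all add: p_def)
    moreover have "0 < C j" "0 < C (Suc j)" using j C_pos by auto
    ultimately have "p I j j / C j \<le> p I (Suc j) j / C (Suc j)"
      using divide_le_of_cross_mult[OF _ _ _ _ _ ratio cross] by blast
    then show ?thesis by (simp add: d_def)
  qed
  then have "(\<Sum>I\<in>Is. \<Sum>j=k..<n. d I j) \<le> 0" by (intro sum_nonpos) auto
  moreover have "(\<Sum>I\<in>Is. \<Sum>j=k..<n. d I j) = 0"
    if ind: "indep_vars (\<lambda>_. borel) X {1..n}"
      and const: "\<forall>I. I \<subseteq> {1..n} \<and> card I = k \<longrightarrow>
        (\<lambda>j. max_cdf M X I (a j) / real (j choose k)) constant_on {k..n}"
  proof (intro sum.neutral ballI)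
    fix I j assume I: "I \<in> Is" and j: "j \<in> {k..<n}"
    \<comment> \<open>Under independence \<open>q\<close> factors out of both terms of
      \<open>d I j\<close>, as it does not involve the threshold applied to \<open>I\<close>; the
      constant ratios then cancel.\<close>
    define q where "q = prob {\<omega> \<in> space M. clears ({1..n} - I) a k n j (\<lambda>i. X i \<omega>)}"
    have "p I j' j = F I j' * q" for j'
      unfolding p_def q_def F_eq[OF I] using ind Is[OF I] by (intro prob_below_clears_indep)
    then have d_eq: "d I j = (F I j / C j - F I (Suc j) / C (Suc j)) * q"
      by (simp add: d_def left_diff_distrib)
    have "(\<lambda>j. F I j / C j) constant_on {k..n}"
      using const I by (simp add: F_def C_def Is_def)
    then have "F I j / C j = F I (Suc j) / C (Suc j)"
      using j by (auto simp: constant_on_def)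
    then show "d I j = 0" by (simp add: d_eq)
  qed
  ultimately show ?thesis
    unfolding compl B_eq by (simp add: Is_def F_def C_def)
qed

end
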